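(* Let $L$ be a lattice with a least element $0$ and let $v\colon L\rightarrow\mathbb{R}_{\geq 0}$ be a positive sub-valuation with $v(0)=0$. Let $\delta_v\colon L\rightarrow \mathbb{R}_{\geq 0}$ be given by $$\delta_v(a)=\begin{cases} 0, & a\in A(L),\\ v(a), & \text{otherwise,}\end{cases}$$ where $A(L)$ is the set of atoms of $L$. Then $(L,\delta_v)$ is a strictly monotone lattice diversity.
   Context: In a lattice $L$ with least element $0$, the atoms are the elements $a$ that cover $0$, i.e. $a>0$ and there is no $c\in L$ with $0<c<a$; $A(L)$ is the set of atoms. Lattice diversity: let $L$ be a lattice with least element $0$ and let $\delta\colon L\to\mathbb{R}_{\ge 0}$. The pair $(L,\delta)$ is a lattice diversity if for all $a,b\in L$: (1) $\delta(a)=0$ if and only if $a\in A(L)$ or $a=0$; (2) $a\le b$ implies $\delta(a)\le\delta(b)$; (3) $a\wedge b\ne 0$ implies $\delta(a\vee b)\le\delta(a)+\delta(b)$. A lattice diversity $(L,\delta)$ is strictly monotone if $a<b$ implies $\delta(a)<\delta(b)$ for all $a,b\neq 0$. A sub-valuation on a lattice $L$ is a non-negative real-valued function $v$ on $L$ such that $v(a\wedge b)+v(a\vee b)\le v(a)+v(b)$ for all $a,b\in L$. It is positive if $v(a)<v(b)$ whenever $a<b$. *)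

theory Defs
  imports Complex_Main
begin

definition lattice_atoms :: "'a::bounded_lattice_bot set" where
  "lattice_atoms = {a. bot < a \<and> \<not> (\<exists>c. bot < c \<and> c < a)}"

text \<open>
  A non-negative real-valued function is represented by a function to \<open>real\<close>;
  the codomain condition appears as a separate conjunct.
\<close>

definition lattice_diversity :: "('a::bounded_lattice_bot \<Rightarrow> real) \<Rightarrow> bool" where
  "lattice_diversity \<delta> \<longleftrightarrow>
     (\<forall>a. 0 \<le> \<delta> a) \<and>
     (\<forall>a. \<delta> a = 0 \<longleftrightarrow> a \<in> lattice_atoms \<or> a = bot) \<and>
     (\<forall>a b. a \<le> b \<longrightarrow> \<delta> a \<le> \<delta> b) \<and>
     (\<forall>a b. inf a b \<noteq> bot \<longrightarrow> \<delta> (sup a b) \<le> \<delta> a + \<delta> b)"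

definition strictly_monotone_lattice_diversity ::
    "('a::bounded_lattice_bot \<Rightarrow> real) \<Rightarrow> bool" where
  "strictly_monotone_lattice_diversity \<delta> \<longleftrightarrow>
     lattice_diversity \<delta> \<and>
     (\<forall>a b. a \<noteq> bot \<longrightarrow> b \<noteq> bot \<longrightarrow> a < b \<longrightarrow> \<delta> a < \<delta> b)"

definition sub_valuation :: "('a::lattice \<Rightarrow> real) \<Rightarrow> bool" where
  "sub_valuation v \<longleftrightarrow>
     (\<forall>a. 0 \<le> v a) \<and>
     (\<forall>a b. v (inf a b) + v (sup a b) \<le> v a + v b)"

definition positive_sub_valuation :: "('a::lattice \<Rightarrow> real) \<Rightarrow> bool" where
  "positive_sub_valuation v \<longleftrightarrow>
     sub_valuation v \<and> (\<forall>a b. a < b \<longrightarrow> v a < v b)"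

definition diversity_of_valuation ::
    "('a::bounded_lattice_bot \<Rightarrow> real) \<Rightarrow> 'a \<Rightarrow> real" where
  "diversity_of_valuation v a = (if a \<in> lattice_atoms then 0 else v a)"

end

theory Submission
  imports Defs
begin

text \<open>
  The function \<open>\<delta> = diversity_of_valuation v\<close> is \<open>v\<close> lowered to \<open>0\<close> at the atoms, so
  \<open>0 \<le> \<delta> \<le> v\<close>. Positivity of \<open>v\<close> together with \<open>v bot = 0\<close> makes \<open>v\<close> vanish only at
  \<open>bot\<close>, hence \<open>\<delta>\<close> vanishes only there and at the atoms. Lowering values could only
  damage monotonicity at an element lying strictly above a nonzero one, and such an element is
  never an atom; there \<open>\<delta>\<close> still agrees with \<open>v\<close> and strictness comes from \<open>v\<close>.

  For the triangle inequality, let \<open>inf a b \<noteq> bot\<close>. If \<open>a\<close> is an atom, then it lies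
  below \<open>b\<close>, so \<open>sup a b = b\<close> and nothing has to be shown beyond \<open>\<delta> a \<ge> 0\<close>; likewise
  for \<open>b\<close>. If neither is an atom, \<open>\<delta>\<close> agrees with \<open>v\<close> at both, and
  \<open>\<delta> (sup a b) \<le> v (sup a b) \<le> v a + v b\<close> by the sub-valuation inequality.
\<close>

lemma not_atom_if_above_nonbot:
  fixes a b :: "'a::bounded_lattice_bot"
  assumes "a \<noteq> bot" "a < b"
  shows "b \<notin> lattice_atoms"
  using assms bot.not_eq_extremum[of a] unfolding lattice_atoms_def by blast

text \<open>
  The only nonzero element below an atom is the atom itself, so a nonzero meet with an atom
  equals the atom.
\<close>

lemma atom_le_if_inf_nonbot:
  fixes a b :: "'a::bounded_lattice_bot"
  assumes "a \<in> lattice_atoms" "inf a b \<noteq> bot"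
  shows "a \<le> b"
proof -
  have "\<not> inf a b < a"
    using assms not_atom_if_above_nonbot by blast
  then have "inf a b = a"
    by (simp add: less_le)
  then show ?thesis
    by (simp add: le_iff_inf)
qed

lemma diversity_of_valuation_nonneg:
  assumes "sub_valuation v"
  shows "0 \<le> diversity_of_valuation v a"
  using assms by (simp add: diversity_of_valuation_def sub_valuation_def)

lemma diversity_of_valuation_le:
  assumes "sub_valuation v"
  shows "diversity_of_valuation v a \<le> v a"
  using assms by (simp add: diversity_of_valuation_def sub_valuation_def)

lemma diversity_of_valuation_strict_mono:
  assumes "positive_sub_valuation v" "a \<noteq> bot" "a < b"
  shows "diversity_of_valuation v a < diversity_of_valuation v b"
proof -
  have "diversity_of_valuation v a \<le> v a"
    using assms(1) by (simp add: diversity_of_valuation_le positive_sub_valuation_def)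
  also have "v a < v b"
    using assms(1,3) by (simp add: positive_sub_valuation_def)
  also have "v b = diversity_of_valuation v b"
    using not_atom_if_above_nonbot[OF assms(2,3)] by (simp add: diversity_of_valuation_def)
  finally show ?thesis .
qed

lemma diversity_of_valuation_eq_0_iff:
  assumes "positive_sub_valuation v" "v bot = 0"
  shows "diversity_of_valuation v a = 0 \<longleftrightarrow> a \<in> lattice_atoms \<or> a = bot"
proof -
  have "v a = 0 \<longleftrightarrow> a = bot"
    using assms by (metis bot.not_eq_extremum less_irrefl positive_sub_valuation_def)
  then show ?thesis
    by (simp add: diversity_of_valuation_def)
qed

lemma diversity_of_valuation_sup_le:
  assumes sub: "sub_valuation v" and ne: "inf a b \<noteq> bot"
  shows "diversity_of_valuation v (sup a b)
    \<le> diversity_of_valuation v a + diversity_of_valuation v b"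
proof -
  consider "a \<in> lattice_atoms" | "b \<in> lattice_atoms"
    | "a \<notin> lattice_atoms" "b \<notin> lattice_atoms" by blast
  then show ?thesis
  proof cases
    case 1
    then have "sup a b = b"
      using atom_le_if_inf_nonbot[OF _ ne] by (blast intro: sup_absorb2)
    then show ?thesis
      using diversity_of_valuation_nonneg[OF sub, of a] by simp
  next
    case 2
    then have "sup a b = a"
      using atom_le_if_inf_nonbot[of b a] ne by (metis inf_commute sup_absorb1)
    then show ?thesis
      using diversity_of_valuation_nonneg[OF sub, of b] by simp
  next
    case 3
    have "diversity_of_valuation v (sup a b) \<le> v (sup a b)"
      by (rule diversity_of_valuation_le[OF sub])
    also have "\<dots> \<le> v (inf a b) + v (sup a b)"
      using sub by (simp add: sub_valuation_def)
    also have "\<dots> \<le> v a + v b"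
      using sub by (simp add: sub_valuation_def)
    finally show ?thesis
      using 3 by (simp add: diversity_of_valuation_def)
  qed
qed

theorem theorem8:
  fixes v :: "'a::bounded_lattice_bot \<Rightarrow> real"
  assumes "positive_sub_valuation v"
    and "v bot = 0"
  shows "strictly_monotone_lattice_diversity (diversity_of_valuation v)"
proof -
  have sub: "sub_valuation v"
    using assms(1) by (simp add: positive_sub_valuation_def)
  have mono: "diversity_of_valuation v a \<le> diversity_of_valuation v b" if "a \<le> b" for a b
  proof (cases "a = bot")
    case True
    then have "diversity_of_valuation v a = 0"
      using diversity_of_valuation_eq_0_iff[OF assms] by blast
    then show ?thesis
      using diversity_of_valuation_nonneg[OF sub, of b] by simp
  next
    case False
    then show ?thesis
      using diversity_of_valuation_strict_mono[OF assms(1) False, of b] that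
      by (cases "a = b") (auto simp: less_le)
  qed
  have "lattice_diversity (diversity_of_valuation v)"
    unfolding lattice_diversity_def
    by (intro conjI allI impI diversity_of_valuation_nonneg[OF sub]
        diversity_of_valuation_eq_0_iff[OF assms] mono diversity_of_valuation_sup_le[OF sub])
  then show ?thesis
    using diversity_of_valuation_strict_mono[OF assms(1)]
    by (simp add: strictly_monotone_lattice_diversity_def)
qed

end
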